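(* Let $l>0$, $c>0$, $T>\frac{2l}{c}$, $a,b\in\mathbb{R}$ with $b\neq 0$, $q\ge 0$, $r>0$, and set $\bar b=-\frac{b^2}{r}$. Let $p\in C^1[0,l]$ be nonnegative with $p(0)=0$, and let $\varphi\in C^1[0,l]$, $\phi\in C^1[0,T]$ satisfy $\varphi(l)=\phi(0)$. Suppose the Riccati equation $$-g_t(z,t)=q+2a\,g(z,t)+\bar b\,g^2(z,t)-c\,g_z(z,t),\qquad g(z,T)=p(z),\quad g(0,t)=0,$$ for $z\in[0,l]$, $t\in[0,T]$, has a solution $g(z,t)$. Define $$\bar a(z,t)=a+\bar b\,g(z,t)\quad (z\in[0,l],\ t\in[0,T]),$$ $$e(z,t)=\exp\Big(-\tfrac1c\int_z^l\bar a\big(\xi,t-\tfrac{\xi-z}{c}\big)d\xi\Big)\quad \big(z\in[0,l],\ t\in[\tfrac{l-z}{c},T]\big).$$ Let $\eta$ be a continuous function on $[0,l]$ with $\eta(l)=\phi(T)$ and $\eta(0)=e^{-1}(0,T)\,\phi(T-\tfrac{l}{c})$, and define $$\gamma(z)=\Big[e(z,T)\eta(z)-\phi\big(T-\tfrac{l-z}{c}\big)\Big]\,e(z,T)\,c\,\Big[\int_z^l\bar b\,e^2\big(\xi,T-\tfrac{\xi-z}{c}\big)d\xi\Big]^{-1},\qquad z\in[0,l]$$ (the value at $z=l$ being understood as the limit $z\to l^-$). Suppose that the equation $$-\psi_t(z,t)=\bar a(z,t)\psi(z,t)-c\,\psi_z(z,t),\qquad \psi(z,T)=\gamma(z),\quad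 \psi(0,t)=0,$$ for $z\in[0,l]$, $t\in[0,T]$, has a solution $\psi(z,t)$. Then the constrained optimal control problem, Problem 1 (defined in the context), is solvable. The optimal control is given by $$u^*(z,t)=-\frac{b}{r}\big[g(z,t)x^*(z,t)+\psi(z,t)\big],$$ where the optimal state $x^*(z,t)$ satisfies $$x^*_t(z,t)-c\,x^*_z(z,t)=\bar a(z,t)x^*(z,t)+\bar b\,\psi(z,t),\qquad x^*(z,0)=\varphi(z),\quad x^*(l,t)=\phi(t),$$ for $z\in[0,l]$, $t\in[0,T]$. The corresponding optimal cost is $$J^*=\frac12\Big\{\int_0^T c\,\phi(t)\big[g(l,t)\phi(t)+\psi(l,t)\big]dt+\int_0^l\varphi(z)\big[g(z,0)\varphi(z)+\psi(z,0)\big]dz-\int_0^l\eta(z)\gamma(z)\,dz\Big\}.$$ Moreover, the optimal costate and the optimal state satisfy $\lambda^*(z,t)=g(z,t)x^*(z,t)+\psi(z,t)$.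
   Context: Subscripts $t,z$ denote partial derivatives. Solutions of the equations are understood as $C^1$ real-valued functions on $[0,l]\times[0,T]$ satisfying the equation and the stated data pointwise. State system: for a continuously differentiable control $u(z,t)$, the state $x(z,t)$ is the $C^1$ solution of $$x_t(z,t)-c\,x_z(z,t)=a\,x(z,t)+b\,u(z,t),\quad x(z,0)=\varphi(z),\quad x(l,t)=\phi(t),\qquad z\in[0,l],\ t\in[0,T].$$ It is a standing assumption that the state system is well posed in the class $C^1$; in particular the closed-loop equation for $x^*$ has a unique $C^1$ solution. Cost: $$J=\frac12\int_0^T\!\!\int_0^l\big[q\,x^2(z,t)+r\,u^2(z,t)\big]dz\,dt+\frac12\int_0^l p(z)\,x^2(z,T)\,dz.$$ Problem 1: find the control $u$ minimizing $J$ among all pairs $(u,x)$ with $u$ continuously differentiable and $x$ a $C^1$ solution of the state system with control $u$, subject to the final state constraint $x(z,T)=\eta(z)$ for all $z\in[0,l]$. "Solvable" means that a minimizing control exists; $J^*$ denotes the minimal value. Optimal costate: the function $\lambda^*$ which, together with the optimal pair $(u^*,x^* )$ and the function $\gamma$, satisfies $$-\lambda^*_t(z,t)=-c\,\lambda^*_z(z,t)+a\,\lambda^*(z,t)+q\,x^*(z,t),\quad \lambda^*(z,T)=p(z)x^*(z,T)+\gamma(z),\quad \lambda^*(0,t)=0,$$ and $0=r\,u^*(z,t)+b\,\lambda^*(z,t)$. *)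

theory Defs
  imports "HOL-Analysis.Analysis"
begin

text \<open>
  Functions on \<open>[0,l]\<close> and on \<open>[0,l] \<times> [0,T]\<close> are represented by total functions whose values
  outside the domain are irrelevant: derivatives at the boundary are one-sided, and solutions are
  compared on the domain only. The library predicate \<open>C1_differentiable_on\<close> is not used because it
  asks for two-sided derivatives at the end points.
\<close>

definition C1_on_interval :: "real \<Rightarrow> real \<Rightarrow> (real \<Rightarrow> real) \<Rightarrow> bool" where
  "C1_on_interval \<alpha> \<beta> f \<longleftrightarrow>
     (\<exists>f'. continuous_on {\<alpha>..\<beta>} f' \<and>
       (\<forall>s\<in>{\<alpha>..\<beta>}. (f has_real_derivative f' s) (at s within {\<alpha>..\<beta>})))"

definition C1_partials ::
  "real \<Rightarrow> real \<Rightarrow> (real \<Rightarrow> real \<Rightarrow> real) \<Rightarrow> (real \<Rightarrow> real \<Rightarrow> real) \<Rightarrow> (real \<Rightarrow> real \<Rightarrow> real) \<Rightarrow> bool" where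
  "C1_partials l T f f\<^sub>z f\<^sub>t \<longleftrightarrow>
     continuous_on ({0..l} \<times> {0..T}) (\<lambda>(z, t). f\<^sub>z z t) \<and>
     continuous_on ({0..l} \<times> {0..T}) (\<lambda>(z, t). f\<^sub>t z t) \<and>
     (\<forall>z\<in>{0..l}. \<forall>t\<in>{0..T}.
        ((\<lambda>\<zeta>. f \<zeta> t) has_real_derivative f\<^sub>z z t) (at z within {0..l}) \<and>
        ((\<lambda>\<tau>. f z \<tau>) has_real_derivative f\<^sub>t z t) (at t within {0..T}))"

definition C1_on_rectangle :: "real \<Rightarrow> real \<Rightarrow> (real \<Rightarrow> real \<Rightarrow> real) \<Rightarrow> bool" where
  "C1_on_rectangle l T f \<longleftrightarrow> (\<exists>f\<^sub>z f\<^sub>t. C1_partials l T f f\<^sub>z f\<^sub>t)"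

definition eq_on_rectangle ::
  "real \<Rightarrow> real \<Rightarrow> (real \<Rightarrow> real \<Rightarrow> real) \<Rightarrow> (real \<Rightarrow> real \<Rightarrow> real) \<Rightarrow> bool" where
  "eq_on_rectangle l T f h \<longleftrightarrow> (\<forall>z\<in>{0..l}. \<forall>t\<in>{0..T}. f z t = h z t)"

text \<open>
  \<open>x\<^sub>t - c x\<^sub>z = F(z,t,x)\<close> with initial data at \<open>t = 0\<close> and boundary data at \<open>z = l\<close>.
\<close>

definition forward_solution ::
  "real \<Rightarrow> real \<Rightarrow> real \<Rightarrow> (real \<Rightarrow> real \<Rightarrow> real \<Rightarrow> real) \<Rightarrow> (real \<Rightarrow> real) \<Rightarrow> (real \<Rightarrow> real) \<Rightarrow>
   (real \<Rightarrow> real \<Rightarrow> real) \<Rightarrow> bool" where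
  "forward_solution l T c F x_init x_bd x \<longleftrightarrow>
     (\<exists>x\<^sub>z x\<^sub>t. C1_partials l T x x\<^sub>z x\<^sub>t \<and>
       (\<forall>z\<in>{0..l}. \<forall>t\<in>{0..T}. x\<^sub>t z t - c * x\<^sub>z z t = F z t (x z t))) \<and>
     (\<forall>z\<in>{0..l}. x z 0 = x_init z) \<and>
     (\<forall>t\<in>{0..T}. x l t = x_bd t)"

text \<open>
  \<open>-y\<^sub>t = F(z,t,y) - c y\<^sub>z\<close> with final data at \<open>t = T\<close> and zero boundary data at \<open>z = 0\<close>.
\<close>

definition backward_solution ::
  "real \<Rightarrow> real \<Rightarrow> real \<Rightarrow> (real \<Rightarrow> real \<Rightarrow> real \<Rightarrow> real) \<Rightarrow> (real \<Rightarrow> real) \<Rightarrow>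
   (real \<Rightarrow> real \<Rightarrow> real) \<Rightarrow> bool" where
  "backward_solution l T c F y_fin y \<longleftrightarrow>
     (\<exists>y\<^sub>z y\<^sub>t. C1_partials l T y y\<^sub>z y\<^sub>t \<and>
       (\<forall>z\<in>{0..l}. \<forall>t\<in>{0..T}. - y\<^sub>t z t = F z t (y z t) - c * y\<^sub>z z t)) \<and>
     (\<forall>z\<in>{0..l}. y z T = y_fin z) \<and>
     (\<forall>t\<in>{0..T}. y 0 t = 0)"

definition state_solution ::
  "real \<Rightarrow> real \<Rightarrow> real \<Rightarrow> real \<Rightarrow> real \<Rightarrow> (real \<Rightarrow> real) \<Rightarrow> (real \<Rightarrow> real) \<Rightarrow>
   (real \<Rightarrow> real \<Rightarrow> real) \<Rightarrow> (real \<Rightarrow> real \<Rightarrow> real) \<Rightarrow> bool" where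
  "state_solution l T c a b x_init x_bd u x \<longleftrightarrow>
     forward_solution l T c (\<lambda>z t y. a * y + b * u z t) x_init x_bd x"

definition cost ::
  "real \<Rightarrow> real \<Rightarrow> real \<Rightarrow> real \<Rightarrow> (real \<Rightarrow> real) \<Rightarrow>
   (real \<Rightarrow> real \<Rightarrow> real) \<Rightarrow> (real \<Rightarrow> real \<Rightarrow> real) \<Rightarrow> real" where
  "cost l T q r p u x =
     1/2 * integral {0..T} (\<lambda>t. integral {0..l} (\<lambda>z. q * (x z t)\<^sup>2 + r * (u z t)\<^sup>2)) +
     1/2 * integral {0..l} (\<lambda>z. p z * (x z T)\<^sup>2)"

definition admissible_pair ::
  "real \<Rightarrow> real \<Rightarrow> real \<Rightarrow> real \<Rightarrow> real \<Rightarrow> (real \<Rightarrow> real) \<Rightarrow> (real \<Rightarrow> real) \<Rightarrow> (real \<Rightarrow> real) \<Rightarrow>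
   (real \<Rightarrow> real \<Rightarrow> real) \<Rightarrow> (real \<Rightarrow> real \<Rightarrow> real) \<Rightarrow> bool" where
  "admissible_pair l T c a b x_init x_bd \<eta> u x \<longleftrightarrow>
     C1_on_rectangle l T u \<and>
     state_solution l T c a b x_init x_bd u x \<and>
     (\<forall>z\<in>{0..l}. x z T = \<eta> z)"

definition optimal_pair ::
  "real \<Rightarrow> real \<Rightarrow> real \<Rightarrow> real \<Rightarrow> real \<Rightarrow> real \<Rightarrow> real \<Rightarrow> (real \<Rightarrow> real) \<Rightarrow>
   (real \<Rightarrow> real) \<Rightarrow> (real \<Rightarrow> real) \<Rightarrow> (real \<Rightarrow> real) \<Rightarrow>
   (real \<Rightarrow> real \<Rightarrow> real) \<Rightarrow> (real \<Rightarrow> real \<Rightarrow> real) \<Rightarrow> bool" where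
  "optimal_pair l T c a b q r p x_init x_bd \<eta> u x \<longleftrightarrow>
     admissible_pair l T c a b x_init x_bd \<eta> u x \<and>
     (\<forall>v y. admissible_pair l T c a b x_init x_bd \<eta> v y \<longrightarrow>
        cost l T q r p u x \<le> cost l T q r p v y)"

definition solvable ::
  "real \<Rightarrow> real \<Rightarrow> real \<Rightarrow> real \<Rightarrow> real \<Rightarrow> real \<Rightarrow> real \<Rightarrow> (real \<Rightarrow> real) \<Rightarrow>
   (real \<Rightarrow> real) \<Rightarrow> (real \<Rightarrow> real) \<Rightarrow> (real \<Rightarrow> real) \<Rightarrow> bool" where
  "solvable l T c a b q r p x_init x_bd \<eta> \<longleftrightarrow>
     (\<exists>u x. optimal_pair l T c a b q r p x_init x_bd \<eta> u x)"

definition optimal_costate ::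
  "real \<Rightarrow> real \<Rightarrow> real \<Rightarrow> real \<Rightarrow> real \<Rightarrow> real \<Rightarrow> real \<Rightarrow> (real \<Rightarrow> real) \<Rightarrow> (real \<Rightarrow> real) \<Rightarrow>
   (real \<Rightarrow> real \<Rightarrow> real) \<Rightarrow> (real \<Rightarrow> real \<Rightarrow> real) \<Rightarrow> (real \<Rightarrow> real \<Rightarrow> real) \<Rightarrow> bool" where
  "optimal_costate l T c a b q r p \<gamma> u x \<Lambda> \<longleftrightarrow>
     backward_solution l T c (\<lambda>z t y. a * y + q * x z t) (\<lambda>z. p z * x z T + \<gamma> z) \<Lambda> \<and>
     (\<forall>z\<in>{0..l}. \<forall>t\<in>{0..T}. 0 = r * u z t + b * \<Lambda> z t)"

text \<open>Meaningful for \<open>z \<in> [0,l]\<close> and \<open>t \<in> [(l-z)/c, T]\<close> only.\<close>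

definition char_exp :: "real \<Rightarrow> real \<Rightarrow> (real \<Rightarrow> real \<Rightarrow> real) \<Rightarrow> real \<Rightarrow> real \<Rightarrow> real" where
  "char_exp l c A z t = exp (- (1 / c) * integral {z..l} (\<lambda>\<xi>. A \<xi> (t - (\<xi> - z) / c)))"

end

theory Submission
  imports Defs
begin

text \<open>
  The proof is a verification argument by completing the square. Let \<open>g\<close> solve the Riccati equation
  and \<open>\<psi>\<close> the linear costate equation, and set \<open>W = 1/2 g x\<^sup>2 + \<psi> x\<close> for an arbitrary admissible
  pair \<open>(u, x)\<close>. The three equations give, pointwise,
  \<open>W\<^sub>t - c W\<^sub>z = - 1/2 (q x\<^sup>2 + r u\<^sup>2) + r/2 (u + b/r (g x + \<psi>))\<^sup>2 + bbar/2 \<psi>\<^sup>2\<close>. The left-hand side is a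
  divergence, so its integral over the rectangle is a boundary term
  (\<open>rect_integral_transport\<close>). On the boundary \<open>x\<close> is prescribed at \<open>t = 0\<close>, \<open>z = l\<close> and, by the
  final state constraint, at \<open>t = T\<close>, while \<open>g\<close> and \<open>\<psi>\<close> vanish at \<open>z = 0\<close>. Hence the cost of every
  admissible pair is the integral of \<open>r/2 (u + b/r (g x + \<psi>))\<^sup>2\<close> plus a constant that depends on the
  data only (\<open>cost_completed_square\<close>). It is minimal exactly when the square vanishes
  identically, that is, for the feedback law; uniqueness of the closed-loop state then gives
  uniqueness of the minimizing pair.

  What remains is that the feedback law is admissible, i.e. that it steers the state to \<open>\<eta>\<close>. This
  is decided on the characteristic through \<open>(z, T)\<close>, along which \<open>t + z/c\<close> is constant. Because
  \<open>T \<ge> l/c\<close>, tracing it back in time ends on the side \<open>z = l\<close>, where the boundary data act. Along it, \<open>\<psi>\<close> is a multiple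
  of the integrating factor \<open>e\<close>, and \<open>e x\<close> changes at the rate \<open>- bbar e \<psi> / c\<close>, so \<open>e(z,T) x(z,T)\<close> is
  an affine function of the single number \<open>\<gamma>(z)\<close> (\<open>closed_loop_final_state\<close>). The formula for
  \<open>\<gamma>\<close> solves this affine equation for \<open>x(z,T) = \<eta>(z)\<close>.

  The constant in the cost contains the integral of \<open>bbar \<psi>\<^sup>2\<close>. For the closed-loop state \<open>x\<close>
  this function is the divergence of \<open>\<psi> x\<close> (\<open>closed_loop_psi_energy\<close>), which turns the constant into the
  stated value. The costate equation for \<open>g x + \<psi>\<close> is a pointwise computation
  (\<open>costate_feedback\<close>), and the costate is unique because \<open>0 = r u + b \<Lambda>\<close> with \<open>b \<noteq> 0\<close> determines it.
\<close>

section \<open>Calculus of functions with continuous partial derivatives\<close>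

text \<open>
  Continuous partial derivatives imply Frechet differentiability on the closed rectangle, boundary
  included. Joint continuity and differentiation along characteristics both rest on this.
\<close>

lemma C1_partials_imp_has_derivative:
  assumes f: "C1_partials l T f f\<^sub>z f\<^sub>t" and zt: "z \<in> {0..l}" "t \<in> {0..T}"
  shows "((\<lambda>(z, t). f z t) has_derivative (\<lambda>(h, k). f\<^sub>z z t * h + f\<^sub>t z t * k))
           (at (z, t) within {0..l} \<times> {0..T})"
proof -
  have "((\<lambda>(z, t). f z t) has_derivative
          (\<lambda>(h, k). f\<^sub>z z t * h + blinfun_apply (blinfun_mult_right (f\<^sub>t z t)) k))
          (at (z, t) within {0..l} \<times> {0..T})"
  proof (rule has_derivative_partialsI)
    show "((\<lambda>\<zeta>. f \<zeta> t) has_derivative (*) (f\<^sub>z z t)) (at z within {0..l})"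
      using f zt by (simp add: C1_partials_def has_field_derivative_def)
    show "((\<lambda>\<tau>. f x \<tau>) has_derivative blinfun_apply (blinfun_mult_right (f\<^sub>t x y)))
            (at y within {0..T})" if "x \<in> {0..l}" "y \<in> {0..T}" for x y
      using f that by (simp add: C1_partials_def has_field_derivative_def)
    have "continuous_on ({0..l} \<times> {0..T}) (\<lambda>v. blinfun_mult_right (case v of (x, y) \<Rightarrow> f\<^sub>t x y))"
      using f by (intro bounded_linear.continuous_on[OF bounded_linear_blinfun_mult_right])
        (simp add: C1_partials_def)
    moreover have "(\<lambda>v. blinfun_mult_right (case v of (x, y) \<Rightarrow> f\<^sub>t x y))
                     = (\<lambda>(x, y). blinfun_mult_right (f\<^sub>t x y))"
      by auto
    ultimately show "continuous (at (z, t) within {0..l} \<times> {0..T})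
                       (\<lambda>(x, y). blinfun_mult_right (f\<^sub>t x y))"
      using zt by (simp add: continuous_on_eq_continuous_within)
  qed (use zt in auto)
  then show ?thesis by simp
qed

lemma C1_partials_continuous_on:
  assumes "C1_partials l T f f\<^sub>z f\<^sub>t"
  shows "continuous_on ({0..l} \<times> {0..T}) (\<lambda>(z, t). f z t)"
  by (rule has_derivative_continuous_on[where f' = "\<lambda>(z, t) (h, k). f\<^sub>z z t * h + f\<^sub>t z t * k"])
    (use C1_partials_imp_has_derivative[OF assms] in auto)

lemma C1_partials_const: "C1_partials l T (\<lambda>z t. k) (\<lambda>z t. 0) (\<lambda>z t. 0)"
  by (simp add: C1_partials_def case_prod_unfold)

lemma C1_partials_add:
  assumes "C1_partials l T f f\<^sub>z f\<^sub>t" "C1_partials l T h h\<^sub>z h\<^sub>t"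
  shows "C1_partials l T (\<lambda>z t. f z t + h z t)
           (\<lambda>z t. f\<^sub>z z t + h\<^sub>z z t) (\<lambda>z t. f\<^sub>t z t + h\<^sub>t z t)"
  using assms unfolding C1_partials_def case_prod_unfold
  by (auto intro!: derivative_intros continuous_intros)

lemma C1_partials_mult:
  assumes f: "C1_partials l T f f\<^sub>z f\<^sub>t" and h: "C1_partials l T h h\<^sub>z h\<^sub>t"
  shows "C1_partials l T (\<lambda>z t. f z t * h z t)
           (\<lambda>z t. f z t * h\<^sub>z z t + f\<^sub>z z t * h z t) (\<lambda>z t. f z t * h\<^sub>t z t + f\<^sub>t z t * h z t)"
  using assms C1_partials_continuous_on[OF f] C1_partials_continuous_on[OF h]
  unfolding C1_partials_def case_prod_unfold
  by (auto intro!: derivative_eq_intros continuous_intros)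

lemma C1_partials_slices_continuous_on:
  assumes f: "C1_partials l T f f\<^sub>z f\<^sub>t"
  shows "t \<in> {0..T} \<Longrightarrow> continuous_on {0..l} (\<lambda>z. f z t)"
    and "z \<in> {0..l} \<Longrightarrow> continuous_on {0..T} (\<lambda>t. f z t)"
proof -
  show "continuous_on {0..l} (\<lambda>z. f z t)" if "t \<in> {0..T}"
    using f that unfolding C1_partials_def
    by (intro DERIV_continuous_on[where D = "\<lambda>z. f\<^sub>z z t"]) auto
  show "continuous_on {0..T} (\<lambda>t. f z t)" if "z \<in> {0..l}"
    using f that unfolding C1_partials_def
    by (intro DERIV_continuous_on[where D = "\<lambda>t. f\<^sub>t z t"]) auto
qed

section \<open>Integrals over the rectangle\<close>

text \<open>
  The cost is an iterated integral. The integral over the product set is linear on continuous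
  integrands and can be iterated in either order.
\<close>

definition rect_integral :: "real \<Rightarrow> real \<Rightarrow> (real \<Rightarrow> real \<Rightarrow> real) \<Rightarrow> real" where
  "rect_integral l T F = integral ({0..l} \<times> {0..T}) (\<lambda>(z, t). F z t)"

lemma rect_eq_cbox: "{0..l} \<times> {0..T} = cbox (0, 0) (l, T)" for l T :: real
  by (simp add: cbox_Pair_eq)

lemma
  assumes F: "continuous_on ({0..l} \<times> {0..T}) (\<lambda>(z, t). F z t)"
  shows rect_integral_zt: "rect_integral l T F = integral {0..l} (\<lambda>z. integral {0..T} (F z))"
    and rect_integral_tz: "rect_integral l T F = integral {0..T} (\<lambda>t. integral {0..l} (\<lambda>z. F z t))"
proof -
  show zt: "rect_integral l T F = integral {0..l} (\<lambda>z. integral {0..T} (F z))"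
    using integral_prod_continuous[of "0" "0" l T "\<lambda>(z, t). F z t"] F
    by (simp add: rect_integral_def rect_eq_cbox)
  show "rect_integral l T F = integral {0..T} (\<lambda>t. integral {0..l} (\<lambda>z. F z t))"
    using integral_swap_continuous[of "0" "0" l T F] F
    by (simp add: zt rect_eq_cbox)
qed

lemma rect_integral_add:
  assumes "continuous_on ({0..l} \<times> {0..T}) (\<lambda>(z, t). F z t)"
    and "continuous_on ({0..l} \<times> {0..T}) (\<lambda>(z, t). G z t)"
  shows "rect_integral l T (\<lambda>z t. F z t + G z t) = rect_integral l T F + rect_integral l T G"
  using assms unfolding rect_integral_def rect_eq_cbox case_prod_unfold
  by (intro integral_add integrable_continuous)

lemma rect_integral_cmult:
  "rect_integral l T (\<lambda>z t. k * F z t) = k * rect_integral l T F"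
  by (simp add: rect_integral_def case_prod_unfold)

lemma rect_integral_cong:
  assumes "\<And>z t. z \<in> {0..l} \<Longrightarrow> t \<in> {0..T} \<Longrightarrow> F z t = G z t"
  shows "rect_integral l T F = rect_integral l T G"
  using assms unfolding rect_integral_def by (auto intro!: integral_cong)

lemma rect_integral_nonneg:
  assumes "continuous_on ({0..l} \<times> {0..T}) (\<lambda>(z, t). F z t)"
    and "\<And>z t. z \<in> {0..l} \<Longrightarrow> t \<in> {0..T} \<Longrightarrow> 0 \<le> F z t"
  shows "0 \<le> rect_integral l T F"
  using assms unfolding rect_integral_def rect_eq_cbox
  by (intro integral_nonneg integrable_continuous) (auto simp flip: rect_eq_cbox)

lemma rect_integral_nonneg_eq_0:
  assumes "0 < l" "0 < T"
    and cont: "continuous_on ({0..l} \<times> {0..T}) (\<lambda>(z, t). F z t)"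
    and nonneg: "\<And>z t. z \<in> {0..l} \<Longrightarrow> t \<in> {0..T} \<Longrightarrow> 0 \<le> F z t"
    and "rect_integral l T F = 0" and "z \<in> {0..l}" "t \<in> {0..T}"
  shows "F z t = 0"
proof -
  have "box (0, 0) (l, T) \<noteq> {}"
    using assms(1,2) by (simp add: box_ne_empty Basis_prod_def)
  then have "\<forall>v \<in> cbox (0, 0) (l, T). (case v of (z, t) \<Rightarrow> F z t) = 0"
    using integral_cbox_eq_0_iff[of "(0, 0)" "(l, T)" "\<lambda>(z, t). F z t"] cont nonneg assms(5)
    unfolding rect_integral_def rect_eq_cbox by (auto simp flip: rect_eq_cbox)
  then show ?thesis
    using assms(6,7) by (auto simp flip: rect_eq_cbox)
qed

text \<open>
  The divergence theorem for the vector field \<open>(- c W, W)\<close>: each of the two terms is integrated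
  first in the direction of its derivative.
\<close>

lemma rect_integral_transport:
  assumes "0 \<le> l" "0 \<le> T" and W: "C1_partials l T W W\<^sub>z W\<^sub>t"
  shows "rect_integral l T (\<lambda>z t. W\<^sub>t z t - c * W\<^sub>z z t) =
           integral {0..l} (\<lambda>z. W z T - W z 0) - c * integral {0..T} (\<lambda>t. W l t - W 0 t)"
proof -
  have cz: "continuous_on ({0..l} \<times> {0..T}) (\<lambda>(z, t). W\<^sub>z z t)"
    and ct: "continuous_on ({0..l} \<times> {0..T}) (\<lambda>(z, t). W\<^sub>t z t)"
    using W by (simp_all add: C1_partials_def)
  have "integral {0..T} (W\<^sub>t z) = W z T - W z 0" if "z \<in> {0..l}" for z
    using W that \<open>0 \<le> T\<close>
    by (intro integral_unique fundamental_theorem_of_calculus)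
      (auto simp: C1_partials_def simp flip: has_real_derivative_iff_has_vector_derivative)
  then have t: "rect_integral l T W\<^sub>t = integral {0..l} (\<lambda>z. W z T - W z 0)"
    unfolding rect_integral_zt[OF ct] by (intro integral_cong)
  have "integral {0..l} (\<lambda>z. W\<^sub>z z t) = W l t - W 0 t" if "t \<in> {0..T}" for t
    using W that \<open>0 \<le> l\<close>
    by (intro integral_unique fundamental_theorem_of_calculus[where f = "\<lambda>z. W z t"])
      (auto simp: C1_partials_def simp flip: has_real_derivative_iff_has_vector_derivative)
  then have z: "rect_integral l T W\<^sub>z = integral {0..T} (\<lambda>t. W l t - W 0 t)"
    unfolding rect_integral_tz[OF cz] by (intro integral_cong)
  have "rect_integral l T (\<lambda>z t. W\<^sub>t z t + (- c) * W\<^sub>z z t)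
          = rect_integral l T W\<^sub>t + rect_integral l T (\<lambda>z t. (- c) * W\<^sub>z z t)"
    using cz ct unfolding case_prod_unfold
    by (intro rect_integral_add) (auto simp: case_prod_unfold intro!: continuous_intros)
  then show ?thesis
    by (simp only: rect_integral_cmult t z) simp
qed

section \<open>Characteristics and the reached final state\<close>

lemma characteristic_in_rectangle:
  fixes c l T :: real
  assumes "0 < c" "l / c \<le> T" "z \<in> {0..l}" "\<xi> \<in> {z..l}"
  shows "T - (\<xi> - z) / c \<in> {0..T}"
proof -
  have "(\<xi> - z) / c \<le> l / c"
    using assms by (intro divide_right_mono) auto
  then show ?thesis using assms by auto
qed

lemma C1_partials_has_derivative_along_characteristic:
  assumes f: "C1_partials l T f f\<^sub>z f\<^sub>t" and c: "0 < c" and T: "l / c \<le> T"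
    and z: "z \<in> {0..l}" and \<xi>: "\<xi> \<in> {z..l}"
  shows "((\<lambda>\<xi>. f \<xi> (T - (\<xi> - z) / c)) has_real_derivative
           - (f\<^sub>t \<xi> (T - (\<xi> - z) / c) - c * f\<^sub>z \<xi> (T - (\<xi> - z) / c)) / c) (at \<xi> within {z..l})"
proof -
  let ?\<sigma> = "\<lambda>\<xi>. (\<xi>, T - (\<xi> - z) / c)"
  let ?D = "\<lambda>(z, t) (h, k). f\<^sub>z z t * h + f\<^sub>t z t * k"
  have "((\<lambda>\<xi>. (\<lambda>(z, t). f z t) (?\<sigma> \<xi>)) has_derivative (\<lambda>h. ?D (?\<sigma> \<xi>) (h, - h / c)))
          (at \<xi> within {z..l})"
  proof (rule has_derivative_in_compose2[where t = "{0..l} \<times> {0..T}"])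
    show "((\<lambda>(z, t). f z t) has_derivative ?D v) (at v within {0..l} \<times> {0..T})"
      if "v \<in> {0..l} \<times> {0..T}" for v
      using C1_partials_imp_has_derivative[OF f] that by auto
    show "?\<sigma> ` {z..l} \<subseteq> {0..l} \<times> {0..T}"
    proof
      fix v assume "v \<in> ?\<sigma> ` {z..l}"
      then obtain s where "s \<in> {z..l}" "v = ?\<sigma> s" by auto
      then show "v \<in> {0..l} \<times> {0..T}"
        using characteristic_in_rectangle[OF c T z, of s] z by auto
    qed
    show "(?\<sigma> has_derivative (\<lambda>h. (h, - h / c))) (at \<xi> within {z..l})"
      using c by (auto intro!: derivative_eq_intros simp: field_simps)
  qed (rule \<xi>)
  moreover have "(\<lambda>h. ?D (?\<sigma> \<xi>) (h, - h / c)) =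
      (*) (- (f\<^sub>t \<xi> (T - (\<xi> - z) / c) - c * f\<^sub>z \<xi> (T - (\<xi> - z) / c)) / c)"
    using c by (auto simp: field_simps)
  ultimately show ?thesis
    by (simp add: has_field_derivative_def)
qed

lemma continuous_on_characteristic:
  fixes A :: "real \<Rightarrow> real \<Rightarrow> real"
  assumes A: "continuous_on ({0..l} \<times> {0..T}) (\<lambda>(z, t). A z t)"
    and c: "0 < c" and T: "l / c \<le> T" and z: "z \<in> {0..l}"
  shows "continuous_on {z..l} (\<lambda>s. A s (T - (s - z) / c))"
proof -
  have "continuous_on {z..l} (\<lambda>s. (\<lambda>(z, t). A z t) (s, T - (s - z) / c))"
    using characteristic_in_rectangle[OF c T z] c z
    by (intro continuous_on_compose2[OF A] continuous_intros) auto
  then show ?thesis by simp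
qed

lemma char_exp_on_characteristic:
  "char_exp l c A \<xi> (T - (\<xi> - z) / c) = exp (- (1 / c) * integral {\<xi>..l} (\<lambda>s. A s (T - (s - z) / c)))"
proof -
  have "T - (\<xi> - z) / c - (s - \<xi>) / c = T - (s - z) / c" for s
    by (simp add: diff_divide_distrib)
  then show ?thesis by (simp only: char_exp_def)
qed

lemma char_exp_has_derivative_along_characteristic:
  assumes A: "continuous_on {z..l} (\<lambda>s. A s (T - (s - z) / c))" and \<xi>: "\<xi> \<in> {z..l}"
  shows "((\<lambda>\<xi>. char_exp l c A \<xi> (T - (\<xi> - z) / c)) has_real_derivative
           A \<xi> (T - (\<xi> - z) / c) / c * char_exp l c A \<xi> (T - (\<xi> - z) / c)) (at \<xi> within {z..l})"
  unfolding char_exp_on_characteristic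
  by (rule derivative_eq_intros integral_has_real_derivative'[OF A \<xi>] refl)+ simp


text \<open>This keeps the definition of \<open>\<gamma>\<close> from dividing by zero when \<open>z < l\<close>.\<close>

lemma char_exp_square_integral_pos:
  assumes A: "continuous_on ({0..l} \<times> {0..T}) (\<lambda>(z, t). A z t)"
    and c: "0 < c" and T: "l / c \<le> T" and z: "z \<in> {0..<l}"
  shows "0 < integral {z..l} (\<lambda>\<xi>. (char_exp l c A \<xi> (T - (\<xi> - z) / c))\<^sup>2)"
proof -
  let ?E = "\<lambda>\<xi>. char_exp l c A \<xi> (T - (\<xi> - z) / c)"
  have "continuous_on {z..l} ?E"
    using z by (intro DERIV_continuous_on[OF char_exp_has_derivative_along_characteristic]
        continuous_on_characteristic[OF A c T]) auto
  then have cont: "continuous_on {z..l} (\<lambda>\<xi>. (?E \<xi>)\<^sup>2)"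
    by (intro continuous_intros)
  have "?E z \<noteq> 0"
    by (simp add: char_exp_def)
  then have "integral {z..l} (\<lambda>\<xi>. (?E \<xi>)\<^sup>2) \<noteq> 0"
    using integral_eq_0_iff[OF cont] z by force
  moreover have "0 \<le> integral {z..l} (\<lambda>\<xi>. (?E \<xi>)\<^sup>2)"
    by (intro integral_nonneg integrable_continuous_interval cont) simp
  ultimately show ?thesis by simp
qed

text \<open>
  The solution of the closed-loop equation by characteristics. Both \<open>\<psi>\<close> and \<open>e = char_exp l c A\<close>
  satisfy \<open>y' = (A/c) y\<close> along the characteristic through \<open>(z, T)\<close>, so \<open>\<psi> = (\<gamma> z / e z T) e\<close>
  there; inserting this into \<open>(e x)' = - k e \<psi> / c\<close> and integrating from \<open>z\<close> to \<open>l\<close>, where \<open>e = 1\<close> and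
  \<open>x\<close> is the boundary value, gives the formula.
\<close>

lemma closed_loop_final_state:
  assumes c: "0 < c" and T: "l / c \<le> T" and z: "z \<in> {0..l}"
    and A: "continuous_on ({0..l} \<times> {0..T}) (\<lambda>(z, t). A z t)"
    and \<psi>: "backward_solution l T c (\<lambda>z t y. A z t * y) \<gamma> \<psi>"
    and x: "forward_solution l T c (\<lambda>z t y. A z t * y + k * \<psi> z t) x_init x_bd x"
  shows "char_exp l c A z T * x z T = x_bd (T - (l - z) / c) +
    \<gamma> z / (c * char_exp l c A z T) * integral {z..l} (\<lambda>\<xi>. k * (char_exp l c A \<xi> (T - (\<xi> - z) / c))\<^sup>2)"
proof -
  define \<tau> where "\<tau> = (\<lambda>\<xi>. T - (\<xi> - z) / c)"
  define E where "E = (\<lambda>\<xi>. char_exp l c A \<xi> (\<tau> \<xi>))"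
  obtain \<psi>\<^sub>z \<psi>\<^sub>t where \<psi>p: "C1_partials l T \<psi> \<psi>\<^sub>z \<psi>\<^sub>t"
    and \<psi>eq: "\<And>z t. z \<in> {0..l} \<Longrightarrow> t \<in> {0..T} \<Longrightarrow> - \<psi>\<^sub>t z t = A z t * \<psi> z t - c * \<psi>\<^sub>z z t"
    and \<psi>T: "\<psi> z T = \<gamma> z"
    using \<psi> z unfolding backward_solution_def by blast
  obtain x\<^sub>z x\<^sub>t where xp: "C1_partials l T x x\<^sub>z x\<^sub>t"
    and xeq: "\<And>z t. z \<in> {0..l} \<Longrightarrow> t \<in> {0..T} \<Longrightarrow>
                x\<^sub>t z t - c * x\<^sub>z z t = A z t * x z t + k * \<psi> z t"
    and xl: "\<And>t. t \<in> {0..T} \<Longrightarrow> x l t = x_bd t"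
    using x unfolding forward_solution_def by blast
  have in_rect: "\<xi> \<in> {0..l}" "\<tau> \<xi> \<in> {0..T}" if "\<xi> \<in> {z..l}" for \<xi>
    using characteristic_in_rectangle[OF c T z that] that z by (auto simp: \<tau>_def)
  have E_pos: "0 < E \<xi>" for \<xi>
    by (simp add: E_def char_exp_def)
  have E_z: "E z = char_exp l c A z T"
    by (simp add: E_def \<tau>_def)
  have E_l: "E l = 1"
    by (simp add: E_def char_exp_def)
  have E': "(E has_real_derivative A \<xi> (\<tau> \<xi>) / c * E \<xi>) (at \<xi> within {z..l})"
    if "\<xi> \<in> {z..l}" for \<xi>
    using char_exp_has_derivative_along_characteristic[where A = A and c = c and T = T and z = z,
        OF continuous_on_characteristic[OF A c T z] that]
    unfolding E_def \<tau>_def by simp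
  have \<psi>': "((\<lambda>\<xi>. \<psi> \<xi> (\<tau> \<xi>)) has_real_derivative A \<xi> (\<tau> \<xi>) / c * \<psi> \<xi> (\<tau> \<xi>)) (at \<xi> within {z..l})"
    if "\<xi> \<in> {z..l}" for \<xi>
  proof -
    have "- (\<psi>\<^sub>t \<xi> (\<tau> \<xi>) - c * \<psi>\<^sub>z \<xi> (\<tau> \<xi>)) / c = A \<xi> (\<tau> \<xi>) / c * \<psi> \<xi> (\<tau> \<xi>)"
      using \<psi>eq[OF in_rect[OF that]] by (simp add: algebra_simps)
    then show ?thesis
      using C1_partials_has_derivative_along_characteristic[OF \<psi>p c T z that]
      unfolding \<tau>_def by (simp only:)
  qed
  have x': "((\<lambda>\<xi>. x \<xi> (\<tau> \<xi>)) has_real_derivative - (A \<xi> (\<tau> \<xi>) * x \<xi> (\<tau> \<xi>) + k * \<psi> \<xi> (\<tau> \<xi>)) / c)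
              (at \<xi> within {z..l})" if "\<xi> \<in> {z..l}" for \<xi>
    using C1_partials_has_derivative_along_characteristic[OF xp c T z that] xeq[OF in_rect[OF that]]
    unfolding \<tau>_def by (simp only:)
  have "\<exists>C. \<forall>\<xi> \<in> {z..l}. \<psi> \<xi> (\<tau> \<xi>) / E \<xi> = C"
  proof (rule has_field_derivative_zero_constant)
    show "((\<lambda>\<xi>. \<psi> \<xi> (\<tau> \<xi>) / E \<xi>) has_real_derivative 0) (at \<xi> within {z..l})"
      if "\<xi> \<in> {z..l}" for \<xi>
      using E_pos[of \<xi>] by (auto intro!: derivative_eq_intros E'[OF that] \<psi>'[OF that])
  qed simp
  then obtain C where C: "\<And>\<xi>. \<xi> \<in> {z..l} \<Longrightarrow> \<psi> \<xi> (\<tau> \<xi>) / E \<xi> = C"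
    by blast
  have "C = \<gamma> z / E z"
    using C[of z] z \<psi>T by (simp add: \<tau>_def)
  then have \<psi>E: "\<psi> \<xi> (\<tau> \<xi>) = \<gamma> z / E z * E \<xi>" if "\<xi> \<in> {z..l}" for \<xi>
    using C[OF that] E_pos[of \<xi>] by (simp add: field_simps)
  have "((\<lambda>\<xi>. E \<xi> * x \<xi> (\<tau> \<xi>)) has_real_derivative (- \<gamma> z / (c * E z)) * (k * (E \<xi>)\<^sup>2))
          (at \<xi> within {z..l})" if "\<xi> \<in> {z..l}" for \<xi>
    using c E_pos[of z]
    by (auto intro!: derivative_eq_intros E'[OF that] x'[OF that] simp: \<psi>E[OF that] field_simps power2_eq_square)
  then have "((\<lambda>\<xi>. (- \<gamma> z / (c * E z)) * (k * (E \<xi>)\<^sup>2)) has_integral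
               E l * x l (\<tau> l) - E z * x z (\<tau> z)) {z..l}"
    using z by (intro fundamental_theorem_of_calculus)
      (auto simp flip: has_real_derivative_iff_has_vector_derivative)
  then have "(- \<gamma> z / (c * E z)) * integral {z..l} (\<lambda>\<xi>. k * (E \<xi>)\<^sup>2) = E l * x l (\<tau> l) - E z * x z (\<tau> z)"
    by (subst integral_mult_right[symmetric]) (rule integral_unique)
  moreover have "x l (\<tau> l) = x_bd (T - (l - z) / c)" "\<tau> z = T"
    using xl in_rect[of l] z by (simp_all add: \<tau>_def)
  ultimately show ?thesis
    by (simp add: E_l flip: E_z E_def \<tau>_def) (simp add: E_def \<tau>_def)
qed

section \<open>The cost as a completed square\<close>

text \<open>
  Integrate the identity for \<open>W = 1/2 g x\<^sup>2 + \<psi> x\<close> over the rectangle. The Riccati equation removes the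
  terms in \<open>g x\<^sup>2\<close> and the equation of \<open>\<psi>\<close> those in \<open>\<psi> x\<close>; the rest is quadratic in \<open>u\<close>, and
  \<open>bbar = - b\<^sup>2 / r\<close> makes it a square up to \<open>bbar/2 \<psi>\<^sup>2\<close>. The final cost is absorbed by the
  boundary term at \<open>t = T\<close> because \<open>g z T = p z\<close>. Only the last integral still involves the final
  state, which the constraint fixes.
\<close>

lemma cost_completed_square:
  assumes l: "0 < l" and T: "0 < T" and r: "0 < r" and bbar: "bbar = - (b\<^sup>2 / r)"
    and p: "continuous_on {0..l} p"
    and g: "backward_solution l T c (\<lambda>z t y. q + 2 * a * y + bbar * y\<^sup>2) p g"
    and \<psi>: "backward_solution l T c (\<lambda>z t y. (a + bbar * g z t) * y) \<gamma> \<psi>"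
    and u: "continuous_on ({0..l} \<times> {0..T}) (\<lambda>(z, t). u z t)"
    and x: "state_solution l T c a b x_init x_bd u x"
  shows "cost l T q r p u x =
      rect_integral l T (\<lambda>z t. r / 2 * (u z t + b / r * (g z t * x z t + \<psi> z t))\<^sup>2) +
      bbar / 2 * rect_integral l T (\<lambda>z t. (\<psi> z t)\<^sup>2) +
      c * integral {0..T} (\<lambda>t. 1/2 * g l t * (x_bd t)\<^sup>2 + \<psi> l t * x_bd t) +
      integral {0..l} (\<lambda>z. 1/2 * g z 0 * (x_init z)\<^sup>2 + \<psi> z 0 * x_init z) -
      integral {0..l} (\<lambda>z. x z T * \<gamma> z)"
proof -
  obtain g\<^sub>z g\<^sub>t where gp: "C1_partials l T g g\<^sub>z g\<^sub>t"
    and geq: "\<And>z t. z \<in> {0..l} \<Longrightarrow> t \<in> {0..T} \<Longrightarrow>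
                - g\<^sub>t z t = q + 2 * a * g z t + bbar * (g z t)\<^sup>2 - c * g\<^sub>z z t"
    and gT: "\<And>z. z \<in> {0..l} \<Longrightarrow> g z T = p z" and g0: "\<And>t. t \<in> {0..T} \<Longrightarrow> g 0 t = 0"
    using g unfolding backward_solution_def by blast
  obtain \<psi>\<^sub>z \<psi>\<^sub>t where \<psi>p: "C1_partials l T \<psi> \<psi>\<^sub>z \<psi>\<^sub>t"
    and \<psi>eq: "\<And>z t. z \<in> {0..l} \<Longrightarrow> t \<in> {0..T} \<Longrightarrow>
                - \<psi>\<^sub>t z t = (a + bbar * g z t) * \<psi> z t - c * \<psi>\<^sub>z z t"
    and \<psi>T: "\<And>z. z \<in> {0..l} \<Longrightarrow> \<psi> z T = \<gamma> z" and \<psi>0: "\<And>t. t \<in> {0..T} \<Longrightarrow> \<psi> 0 t = 0"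
    using \<psi> unfolding backward_solution_def by blast
  obtain x\<^sub>z x\<^sub>t where xp: "C1_partials l T x x\<^sub>z x\<^sub>t"
    and xeq: "\<And>z t. z \<in> {0..l} \<Longrightarrow> t \<in> {0..T} \<Longrightarrow>
                x\<^sub>t z t - c * x\<^sub>z z t = a * x z t + b * u z t"
    and x0: "\<And>z. z \<in> {0..l} \<Longrightarrow> x z 0 = x_init z" and xl: "\<And>t. t \<in> {0..T} \<Longrightarrow> x l t = x_bd t"
    using x unfolding state_solution_def forward_solution_def by blast
  note cont = C1_partials_continuous_on[OF gp] C1_partials_continuous_on[OF \<psi>p]
    C1_partials_continuous_on[OF xp] u
  \<comment> \<open>The factored form lets the product rule produce the partial derivatives of \<open>W\<close>.\<close>
  define W where "W = (\<lambda>z t. (1/2 * g z t * x z t + \<psi> z t) * x z t)"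
  define sq where "sq = (\<lambda>z t. r / 2 * (u z t + b / r * (g z t * x z t + \<psi> z t))\<^sup>2)"
  define run where "run = (\<lambda>z t. q * (x z t)\<^sup>2 + r * (u z t)\<^sup>2)"
  define W\<^sub>z where "W\<^sub>z = (\<lambda>z t. (1/2 * g z t * x z t + \<psi> z t) * x\<^sub>z z t +
    (1/2 * g z t * x\<^sub>z z t + 1/2 * g\<^sub>z z t * x z t + \<psi>\<^sub>z z t) * x z t)"
  define W\<^sub>t where "W\<^sub>t = (\<lambda>z t. (1/2 * g z t * x z t + \<psi> z t) * x\<^sub>t z t +
    (1/2 * g z t * x\<^sub>t z t + 1/2 * g\<^sub>t z t * x z t + \<psi>\<^sub>t z t) * x z t)"
  have Wp: "C1_partials l T W W\<^sub>z W\<^sub>t"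
    using C1_partials_mult[OF C1_partials_add[OF C1_partials_mult[OF
      C1_partials_mult[OF C1_partials_const[of l T "1/2"] gp] xp] \<psi>p] xp]
    by (simp add: W_def W\<^sub>z_def W\<^sub>t_def)
  have sq_eq: "1/2 * run z t = sq z t + (bbar / 2 * (\<psi> z t)\<^sup>2 + (- 1) * (W\<^sub>t z t - c * W\<^sub>z z t))"
    if "z \<in> {0..l}" "t \<in> {0..T}" for z t
  proof -
    have x\<^sub>t: "x\<^sub>t z t = a * x z t + b * u z t + c * x\<^sub>z z t" using xeq[OF that] by simp
    have g\<^sub>t: "g\<^sub>t z t = c * g\<^sub>z z t - (q + 2 * a * g z t + bbar * (g z t)\<^sup>2)" using geq[OF that] by simp
    have \<psi>\<^sub>t: "\<psi>\<^sub>t z t = c * \<psi>\<^sub>z z t - (a + bbar * g z t) * \<psi> z t" using \<psi>eq[OF that] by simp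
    show ?thesis
      using r unfolding run_def sq_def W\<^sub>t_def W\<^sub>z_def x\<^sub>t g\<^sub>t \<psi>\<^sub>t bbar
      by (simp add: field_simps power2_eq_square)
  qed
  have c_run: "continuous_on ({0..l} \<times> {0..T}) (\<lambda>(z, t). run z t)"
    and c_sq: "continuous_on ({0..l} \<times> {0..T}) (\<lambda>(z, t). sq z t)"
    and c_\<psi>: "continuous_on ({0..l} \<times> {0..T}) (\<lambda>(z, t). bbar / 2 * (\<psi> z t)\<^sup>2)"
    using cont r unfolding run_def sq_def case_prod_unfold by (auto intro!: continuous_intros)
  have c_W: "continuous_on ({0..l} \<times> {0..T}) (\<lambda>(z, t). (- 1) * (W\<^sub>t z t - c * W\<^sub>z z t))"
    using Wp unfolding C1_partials_def case_prod_unfold by (auto intro!: continuous_intros)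
  have "1/2 * rect_integral l T run = rect_integral l T (\<lambda>z t. 1/2 * run z t)"
    by (rule rect_integral_cmult[symmetric])
  also have "\<dots> = rect_integral l T
      (\<lambda>z t. sq z t + (bbar / 2 * (\<psi> z t)\<^sup>2 + (- 1) * (W\<^sub>t z t - c * W\<^sub>z z t)))"
    by (rule rect_integral_cong) (rule sq_eq)
  also have "\<dots> = rect_integral l T sq + (bbar / 2 * rect_integral l T (\<lambda>z t. (\<psi> z t)\<^sup>2) +
      (- 1) * rect_integral l T (\<lambda>z t. W\<^sub>t z t - c * W\<^sub>z z t))"
    using c_sq c_\<psi> c_W continuous_on_add[OF c_\<psi> c_W]
    by (simp only: rect_integral_add rect_integral_cmult case_prod_unfold)
  also have "rect_integral l T (\<lambda>z t. W\<^sub>t z t - c * W\<^sub>z z t) =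
      integral {0..l} (\<lambda>z. W z T - W z 0) - c * integral {0..T} (\<lambda>t. W l t - W 0 t)"
    using l T by (intro rect_integral_transport[OF _ _ Wp]) auto
  finally have run: "1/2 * rect_integral l T run = rect_integral l T sq +
      bbar / 2 * rect_integral l T (\<lambda>z t. (\<psi> z t)\<^sup>2) -
      integral {0..l} (\<lambda>z. W z T - W z 0) + c * integral {0..T} (\<lambda>t. W l t - W 0 t)"
    by simp
  have c_xT: "continuous_on {0..l} (\<lambda>z. x z T)" and c_\<psi>T: "continuous_on {0..l} (\<lambda>z. \<psi> z T)"
    and c_W0: "continuous_on {0..l} (\<lambda>z. W z 0)"
    using C1_partials_slices_continuous_on(1)[OF xp, of T]
      C1_partials_slices_continuous_on(1)[OF \<psi>p, of T]
      C1_partials_slices_continuous_on(1)[OF Wp, of 0] T by auto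
  have ints: "(\<lambda>z. 1/2 * (p z * (x z T)\<^sup>2)) integrable_on {0..l}"
    "(\<lambda>z. x z T * \<psi> z T) integrable_on {0..l}" "(\<lambda>z. W z 0) integrable_on {0..l}"
    by (intro integrable_continuous_interval continuous_intros p c_xT c_\<psi>T c_W0)+
  have "integral {0..l} (\<lambda>z. W z T - W z 0) =
      integral {0..l} (\<lambda>z. 1/2 * (p z * (x z T)\<^sup>2) + x z T * \<psi> z T - W z 0)"
    using T by (intro integral_cong) (simp add: W_def gT \<psi>T power2_eq_square algebra_simps)
  also have "\<dots> = integral {0..l} (\<lambda>z. 1/2 * (p z * (x z T)\<^sup>2)) + integral {0..l} (\<lambda>z. x z T * \<psi> z T)
      - integral {0..l} (\<lambda>z. W z 0)"
    using ints by (simp only: integral_diff integral_add integrable_add)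
  also have "integral {0..l} (\<lambda>z. 1/2 * (p z * (x z T)\<^sup>2)) = 1/2 * integral {0..l} (\<lambda>z. p z * (x z T)\<^sup>2)"
    by (rule integral_mult_right)
  also have "integral {0..l} (\<lambda>z. x z T * \<psi> z T) = integral {0..l} (\<lambda>z. x z T * \<gamma> z)"
    by (intro integral_cong) (simp add: \<psi>T)
  also have "integral {0..l} (\<lambda>z. W z 0) =
      integral {0..l} (\<lambda>z. 1/2 * g z 0 * (x_init z)\<^sup>2 + \<psi> z 0 * x_init z)"
    by (intro integral_cong) (simp add: W_def x0 power2_eq_square algebra_simps)
  finally have Wz: "integral {0..l} (\<lambda>z. W z T - W z 0) =
      1/2 * integral {0..l} (\<lambda>z. p z * (x z T)\<^sup>2) + integral {0..l} (\<lambda>z. x z T * \<gamma> z)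
      - integral {0..l} (\<lambda>z. 1/2 * g z 0 * (x_init z)\<^sup>2 + \<psi> z 0 * x_init z)" .
  have Wt: "integral {0..T} (\<lambda>t. W l t - W 0 t) =
      integral {0..T} (\<lambda>t. 1/2 * g l t * (x_bd t)\<^sup>2 + \<psi> l t * x_bd t)"
    using l by (intro integral_cong) (simp add: W_def xl g0 \<psi>0 power2_eq_square algebra_simps)
  have "cost l T q r p u x = 1/2 * rect_integral l T run + 1/2 * integral {0..l} (\<lambda>z. p z * (x z T)\<^sup>2)"
    by (simp add: cost_def rect_integral_tz[OF c_run]) (simp add: run_def)
  then show ?thesis
    unfolding run Wz Wt sq_def by simp
qed


section \<open>The closed loop\<close>

text \<open>
  The closed-loop equation and the equation of \<open>\<psi>\<close> are adjoint up to the forcing \<open>k \<psi>\<close>, so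
  \<open>(\<psi> x)\<^sub>t - c (\<psi> x)\<^sub>z = k \<psi>\<^sup>2\<close>. This expresses the energy of \<open>\<psi>\<close> by boundary data.
\<close>

lemma closed_loop_psi_energy:
  assumes l: "0 < l" and T: "0 < T"
    and \<psi>: "backward_solution l T c (\<lambda>z t y. A z t * y) \<gamma> \<psi>"
    and x: "forward_solution l T c (\<lambda>z t y. A z t * y + k * \<psi> z t) x_init x_bd x"
  shows "k * rect_integral l T (\<lambda>z t. (\<psi> z t)\<^sup>2) =
    integral {0..l} (\<lambda>z. x z T * \<gamma> z) - integral {0..l} (\<lambda>z. \<psi> z 0 * x_init z) -
    c * integral {0..T} (\<lambda>t. \<psi> l t * x_bd t)"
proof -
  obtain \<psi>\<^sub>z \<psi>\<^sub>t where \<psi>p: "C1_partials l T \<psi> \<psi>\<^sub>z \<psi>\<^sub>t"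
    and \<psi>eq: "\<And>z t. z \<in> {0..l} \<Longrightarrow> t \<in> {0..T} \<Longrightarrow> - \<psi>\<^sub>t z t = A z t * \<psi> z t - c * \<psi>\<^sub>z z t"
    and \<psi>T: "\<And>z. z \<in> {0..l} \<Longrightarrow> \<psi> z T = \<gamma> z" and \<psi>0: "\<And>t. t \<in> {0..T} \<Longrightarrow> \<psi> 0 t = 0"
    using \<psi> unfolding backward_solution_def by blast
  obtain x\<^sub>z x\<^sub>t where xp: "C1_partials l T x x\<^sub>z x\<^sub>t"
    and xeq: "\<And>z t. z \<in> {0..l} \<Longrightarrow> t \<in> {0..T} \<Longrightarrow>
                x\<^sub>t z t - c * x\<^sub>z z t = A z t * x z t + k * \<psi> z t"
    and x0: "\<And>z. z \<in> {0..l} \<Longrightarrow> x z 0 = x_init z" and xl: "\<And>t. t \<in> {0..T} \<Longrightarrow> x l t = x_bd t"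
    using x unfolding forward_solution_def by blast
  have "k * rect_integral l T (\<lambda>z t. (\<psi> z t)\<^sup>2) = rect_integral l T (\<lambda>z t. k * (\<psi> z t)\<^sup>2)"
    by (rule rect_integral_cmult[symmetric])
  also have "\<dots> = rect_integral l T (\<lambda>z t. (\<psi> z t * x\<^sub>t z t + \<psi>\<^sub>t z t * x z t) -
      c * (\<psi> z t * x\<^sub>z z t + \<psi>\<^sub>z z t * x z t))"
  proof (rule rect_integral_cong)
    fix z t assume zt: "z \<in> {0..l}" "t \<in> {0..T}"
    have x\<^sub>t: "x\<^sub>t z t = A z t * x z t + k * \<psi> z t + c * x\<^sub>z z t" using xeq[OF zt] by simp
    have \<psi>\<^sub>t: "\<psi>\<^sub>t z t = c * \<psi>\<^sub>z z t - A z t * \<psi> z t" using \<psi>eq[OF zt] by simp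
    show "k * (\<psi> z t)\<^sup>2 = (\<psi> z t * x\<^sub>t z t + \<psi>\<^sub>t z t * x z t) -
      c * (\<psi> z t * x\<^sub>z z t + \<psi>\<^sub>z z t * x z t)"
      unfolding x\<^sub>t \<psi>\<^sub>t by (simp add: algebra_simps power2_eq_square)
  qed
  also have "\<dots> = integral {0..l} (\<lambda>z. \<psi> z T * x z T - \<psi> z 0 * x z 0) -
      c * integral {0..T} (\<lambda>t. \<psi> l t * x l t - \<psi> 0 t * x 0 t)"
    using l T by (intro rect_integral_transport C1_partials_mult \<psi>p xp) auto
  also have "integral {0..T} (\<lambda>t. \<psi> l t * x l t - \<psi> 0 t * x 0 t) = integral {0..T} (\<lambda>t. \<psi> l t * x_bd t)"
    by (intro integral_cong) (simp add: \<psi>0 xl)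
  also have "integral {0..l} (\<lambda>z. \<psi> z T * x z T - \<psi> z 0 * x z 0) =
      integral {0..l} (\<lambda>z. \<psi> z T * x z T) - integral {0..l} (\<lambda>z. \<psi> z 0 * x z 0)"
    using C1_partials_slices_continuous_on(1)[OF xp] C1_partials_slices_continuous_on(1)[OF \<psi>p] T
    by (intro integral_diff integrable_continuous_interval continuous_intros) auto
  also have "integral {0..l} (\<lambda>z. \<psi> z T * x z T) = integral {0..l} (\<lambda>z. x z T * \<gamma> z)"
    by (intro integral_cong) (simp add: \<psi>T)
  also have "integral {0..l} (\<lambda>z. \<psi> z 0 * x z 0) = integral {0..l} (\<lambda>z. \<psi> z 0 * x_init z)"
    by (intro integral_cong) (simp add: x0)
  finally show ?thesis .
qed

text \<open>
  In \<open>(g x + \<psi>)\<^sub>t - c (g x + \<psi>)\<^sub>z\<close> the terms with \<open>bbar\<close> cancel: the quadratic term of the Riccati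
  equation against the feedback in the state equation, and the forcing \<open>bbar g \<psi>\<close> against the
  coefficient of \<open>\<psi>\<close>.
\<close>

lemma costate_feedback:
  assumes g: "backward_solution l T c (\<lambda>z t y. q + 2 * a * y + bbar * y\<^sup>2) p g"
    and \<psi>: "backward_solution l T c (\<lambda>z t y. (a + bbar * g z t) * y) \<gamma> \<psi>"
    and x: "forward_solution l T c (\<lambda>z t y. (a + bbar * g z t) * y + bbar * \<psi> z t) x_init x_bd x"
  shows "backward_solution l T c (\<lambda>z t y. a * y + q * x z t) (\<lambda>z. p z * x z T + \<gamma> z)
    (\<lambda>z t. g z t * x z t + \<psi> z t)"
proof -
  obtain g\<^sub>z g\<^sub>t where gp: "C1_partials l T g g\<^sub>z g\<^sub>t"
    and geq: "\<And>z t. z \<in> {0..l} \<Longrightarrow> t \<in> {0..T} \<Longrightarrow>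
                - g\<^sub>t z t = q + 2 * a * g z t + bbar * (g z t)\<^sup>2 - c * g\<^sub>z z t"
    and gT: "\<And>z. z \<in> {0..l} \<Longrightarrow> g z T = p z" and g0: "\<And>t. t \<in> {0..T} \<Longrightarrow> g 0 t = 0"
    using g unfolding backward_solution_def by blast
  obtain \<psi>\<^sub>z \<psi>\<^sub>t where \<psi>p: "C1_partials l T \<psi> \<psi>\<^sub>z \<psi>\<^sub>t"
    and \<psi>eq: "\<And>z t. z \<in> {0..l} \<Longrightarrow> t \<in> {0..T} \<Longrightarrow>
                - \<psi>\<^sub>t z t = (a + bbar * g z t) * \<psi> z t - c * \<psi>\<^sub>z z t"
    and \<psi>T: "\<And>z. z \<in> {0..l} \<Longrightarrow> \<psi> z T = \<gamma> z" and \<psi>0: "\<And>t. t \<in> {0..T} \<Longrightarrow> \<psi> 0 t = 0"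
    using \<psi> unfolding backward_solution_def by blast
  obtain x\<^sub>z x\<^sub>t where xp: "C1_partials l T x x\<^sub>z x\<^sub>t"
    and xeq: "\<And>z t. z \<in> {0..l} \<Longrightarrow> t \<in> {0..T} \<Longrightarrow>
                x\<^sub>t z t - c * x\<^sub>z z t = (a + bbar * g z t) * x z t + bbar * \<psi> z t"
    using x unfolding forward_solution_def by blast
  have eq: "- (g z t * x\<^sub>t z t + g\<^sub>t z t * x z t + \<psi>\<^sub>t z t) =
      a * (g z t * x z t + \<psi> z t) + q * x z t - c * (g z t * x\<^sub>z z t + g\<^sub>z z t * x z t + \<psi>\<^sub>z z t)"
    if zt: "z \<in> {0..l}" "t \<in> {0..T}" for z t
  proof -
    have x\<^sub>t: "x\<^sub>t z t = (a + bbar * g z t) * x z t + bbar * \<psi> z t + c * x\<^sub>z z t"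
      using xeq[OF zt] by simp
    have g\<^sub>t: "g\<^sub>t z t = c * g\<^sub>z z t - (q + 2 * a * g z t + bbar * (g z t)\<^sup>2)"
      using geq[OF zt] by simp
    have \<psi>\<^sub>t: "\<psi>\<^sub>t z t = c * \<psi>\<^sub>z z t - (a + bbar * g z t) * \<psi> z t"
      using \<psi>eq[OF zt] by simp
    show ?thesis
      unfolding x\<^sub>t g\<^sub>t \<psi>\<^sub>t by (simp add: algebra_simps power2_eq_square)
  qed
  have "C1_partials l T (\<lambda>z t. g z t * x z t + \<psi> z t)
      (\<lambda>z t. g z t * x\<^sub>z z t + g\<^sub>z z t * x z t + \<psi>\<^sub>z z t)
      (\<lambda>z t. g z t * x\<^sub>t z t + g\<^sub>t z t * x z t + \<psi>\<^sub>t z t)"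
    by (intro C1_partials_add C1_partials_mult gp xp \<psi>p)
  then show ?thesis
    unfolding backward_solution_def using eq
    by (intro conjI exI) (auto simp only: gT g0 \<psi>T \<psi>0 mult_zero_left add_0_left)
qed

section \<open>Optimality of the feedback control\<close>

theorem theorem1:
  fixes l c T a b q r bbar :: real
    and p x_init x_bd \<eta> \<gamma> :: "real \<Rightarrow> real"
    and g abar e \<psi> xs us :: "real \<Rightarrow> real \<Rightarrow> real"
  assumes l: "l > 0" and c: "c > 0" and T: "T > 2 * l / c"
    and b: "b \<noteq> 0" and q: "q \<ge> 0" and r: "r > 0"
    and bbar: "bbar = - (b\<^sup>2 / r)"
    and p: "C1_on_interval 0 l p" "\<forall>z\<in>{0..l}. p z \<ge> 0" "p 0 = 0"
    and x_init: "C1_on_interval 0 l x_init"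
    and x_bd: "C1_on_interval 0 T x_bd"
    and compat: "x_init l = x_bd 0"
    and g: "backward_solution l T c (\<lambda>z t y. q + 2 * a * y + bbar * y\<^sup>2) p g"
    and abar: "abar = (\<lambda>z t. a + bbar * g z t)"
    and e: "e = char_exp l c abar"
    and \<eta>: "continuous_on {0..l} \<eta>" "\<eta> l = x_bd T" "\<eta> 0 = inverse (e 0 T) * x_bd (T - l / c)"
    and \<gamma>: "\<forall>z\<in>{0..<l}. \<gamma> z =
          (e z T * \<eta> z - x_bd (T - (l - z) / c)) * e z T * c *
          inverse (integral {z..l} (\<lambda>\<xi>. bbar * (e \<xi> (T - (\<xi> - z) / c))\<^sup>2))"
    and \<gamma>_l: "(\<gamma> \<longlongrightarrow> \<gamma> l) (at_left l)"
    and \<psi>: "backward_solution l T c (\<lambda>z t y. abar z t * y) \<gamma> \<psi>"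
    and xs: "forward_solution l T c (\<lambda>z t y. abar z t * y + bbar * \<psi> z t) x_init x_bd xs"
    and xs_unique: "\<forall>y. forward_solution l T c (\<lambda>z t y. abar z t * y + bbar * \<psi> z t) x_init x_bd y
          \<longrightarrow> eq_on_rectangle l T y xs"
    and us: "us = (\<lambda>z t. - (b / r) * (g z t * xs z t + \<psi> z t))"
  shows "solvable l T c a b q r p x_init x_bd \<eta> \<and>
    optimal_pair l T c a b q r p x_init x_bd \<eta> us xs \<and>
    (\<forall>u x. optimal_pair l T c a b q r p x_init x_bd \<eta> u x \<longrightarrow>
       eq_on_rectangle l T u us \<and> eq_on_rectangle l T x xs) \<and>
    cost l T q r p us xs =
      1/2 * (integral {0..T} (\<lambda>t. c * x_bd t * (g l t * x_bd t + \<psi> l t)) +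
             integral {0..l} (\<lambda>z. x_init z * (g z 0 * x_init z + \<psi> z 0)) -
             integral {0..l} (\<lambda>z. \<eta> z * \<gamma> z)) \<and>
    optimal_costate l T c a b q r p \<gamma> us xs (\<lambda>z t. g z t * xs z t + \<psi> z t) \<and>
    (\<forall>\<Lambda>. optimal_costate l T c a b q r p \<gamma> us xs \<Lambda> \<longrightarrow>
       eq_on_rectangle l T \<Lambda> (\<lambda>z t. g z t * xs z t + \<psi> z t))"
proof -
  define \<Lambda> where "\<Lambda> = (\<lambda>z t. g z t * xs z t + \<psi> z t)"
  have "0 < 2 * l / c" "l / c \<le> 2 * l / c"
    using l c by (auto simp: field_simps)
  then have T0: "0 < T" and lcT: "l / c \<le> T"
    using T by auto
  have \<psi>': "backward_solution l T c (\<lambda>z t y. (a + bbar * g z t) * y) \<gamma> \<psi>"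
    and xs': "forward_solution l T c (\<lambda>z t y. (a + bbar * g z t) * y + bbar * \<psi> z t) x_init x_bd xs"
    using \<psi> xs by (simp_all add: abar)
  obtain g\<^sub>z g\<^sub>t where gp: "C1_partials l T g g\<^sub>z g\<^sub>t"
    using g unfolding backward_solution_def by blast
  obtain \<psi>\<^sub>z \<psi>\<^sub>t where \<psi>p: "C1_partials l T \<psi> \<psi>\<^sub>z \<psi>\<^sub>t"
    using \<psi> unfolding backward_solution_def by blast
  obtain xs\<^sub>z xs\<^sub>t where xsp: "C1_partials l T xs xs\<^sub>z xs\<^sub>t"
    and xseq: "\<And>z t. z \<in> {0..l} \<Longrightarrow> t \<in> {0..T} \<Longrightarrow>
                 xs\<^sub>t z t - c * xs\<^sub>z z t = abar z t * xs z t + bbar * \<psi> z t"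
    and xs0: "\<And>z. z \<in> {0..l} \<Longrightarrow> xs z 0 = x_init z" and xsl: "\<And>t. t \<in> {0..T} \<Longrightarrow> xs l t = x_bd t"
    using xs unfolding forward_solution_def by blast
  have p_cont: "continuous_on {0..l} p"
    using p(1) unfolding C1_on_interval_def by (auto intro: DERIV_continuous_on)
  have abar_cont: "continuous_on ({0..l} \<times> {0..T}) (\<lambda>(z, t). abar z t)"
    using C1_partials_continuous_on[OF gp] unfolding abar case_prod_unfold
    by (intro continuous_intros)
  have closed_loop: "a * y + b * (- (b / r) * (g z t * y + \<psi> z t)) = abar z t * y + bbar * \<psi> z t"
    for y z t
    using r by (simp add: abar bbar field_simps power2_eq_square)

  have "\<exists>u\<^sub>z u\<^sub>t. C1_partials l T us u\<^sub>z u\<^sub>t"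
    unfolding us using C1_partials_mult[OF C1_partials_const[of l T "- (b / r)"]
        C1_partials_add[OF C1_partials_mult[OF gp xsp] \<psi>p]] by blast
  then have us_C1: "C1_on_rectangle l T us"
    by (simp add: C1_on_rectangle_def)
  have us_state: "state_solution l T c a b x_init x_bd us xs"
    unfolding state_solution_def forward_solution_def us closed_loop
    using xsp xseq xs0 xsl by blast

  \<comment> \<open>At \<open>z = l\<close> the target is met by compatibility with the boundary data; for \<open>z < l\<close> the
      choice of \<open>\<gamma>\<close> solves the affine equation for the final state.\<close>
  have reach: "xs z T = \<eta> z" if z: "z \<in> {0..l}" for z
  proof (cases "z = l")
    case True
    then show ?thesis using xsl[of T] T0 \<eta>(2) by simp
  next
    case False
    define N where "N = integral {z..l} (\<lambda>\<xi>. bbar * (e \<xi> (T - (\<xi> - z) / c))\<^sup>2)"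
    have e_pos: "0 < e \<xi> t" for \<xi> t
      by (simp add: e char_exp_def)
    have "N = bbar * integral {z..l} (\<lambda>\<xi>. (e \<xi> (T - (\<xi> - z) / c))\<^sup>2)"
      by (simp add: N_def)
    then have "N \<noteq> 0"
      using char_exp_square_integral_pos[OF abar_cont c lcT, of z] z False b r by (simp add: e bbar)
    have \<gamma>z: "\<gamma> z = (e z T * \<eta> z - x_bd (T - (l - z) / c)) * e z T * c * inverse N"
      unfolding N_def using \<gamma> z False by force
    have "e z T * xs z T = x_bd (T - (l - z) / c) + \<gamma> z / (c * e z T) * N"
      using closed_loop_final_state[OF c lcT z abar_cont \<psi> xs] by (simp add: e N_def)
    also have "\<gamma> z / (c * e z T) * N = e z T * \<eta> z - x_bd (T - (l - z) / c)"
      unfolding \<gamma>z using c e_pos[of z T] \<open>N \<noteq> 0\<close> by (simp add: field_simps)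
    finally show ?thesis
      using e_pos[of z T] by simp
  qed
  have us_adm: "admissible_pair l T c a b x_init x_bd \<eta> us xs"
    using us_C1 us_state reach by (simp add: admissible_pair_def)

  \<comment> \<open>\<open>K\<close> is the part of the cost that all admissible pairs share.\<close>
  define sq where "sq = (\<lambda>u x z t. r / 2 * (u z t + b / r * (g z t * x z t + \<psi> z t))\<^sup>2)"
  define K where "K = bbar / 2 * rect_integral l T (\<lambda>z t. (\<psi> z t)\<^sup>2) +
      c * integral {0..T} (\<lambda>t. 1/2 * g l t * (x_bd t)\<^sup>2 + \<psi> l t * x_bd t) +
      integral {0..l} (\<lambda>z. 1/2 * g z 0 * (x_init z)\<^sup>2 + \<psi> z 0 * x_init z) -
      integral {0..l} (\<lambda>z. \<eta> z * \<gamma> z)"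
  have cost_eq: "cost l T q r p u x = rect_integral l T (sq u x) + K"
    and sq_cont: "continuous_on ({0..l} \<times> {0..T}) (\<lambda>(z, t). sq u x z t)"
    if "admissible_pair l T c a b x_init x_bd \<eta> u x" for u x
  proof -
    have u: "continuous_on ({0..l} \<times> {0..T}) (\<lambda>(z, t). u z t)"
      using that C1_partials_continuous_on unfolding admissible_pair_def C1_on_rectangle_def by blast
    have x: "state_solution l T c a b x_init x_bd u x" and xT: "\<forall>z\<in>{0..l}. x z T = \<eta> z"
      using that by (simp_all add: admissible_pair_def)
    have "integral {0..l} (\<lambda>z. x z T * \<gamma> z) = integral {0..l} (\<lambda>z. \<eta> z * \<gamma> z)"
      using xT by (intro integral_cong) simp
    then show "cost l T q r p u x = rect_integral l T (sq u x) + K"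
      unfolding cost_completed_square[OF l T0 r bbar p_cont g \<psi>' u x] K_def sq_def by simp
    have "continuous_on ({0..l} \<times> {0..T}) (\<lambda>(z, t). x z t)"
      using x C1_partials_continuous_on unfolding state_solution_def forward_solution_def by blast
    then show "continuous_on ({0..l} \<times> {0..T}) (\<lambda>(z, t). sq u x z t)"
      using u C1_partials_continuous_on[OF gp] C1_partials_continuous_on[OF \<psi>p] r
      unfolding sq_def case_prod_unfold by (auto intro!: continuous_intros)
  qed
  have sq_nonneg: "0 \<le> sq u x z t" for u x z t
    using r by (simp add: sq_def)
  \<comment> \<open>Zero is written as a product so that \<open>rect_integral_cmult\<close> evaluates the integral.\<close>
  have "sq us xs = (\<lambda>z t. 0 * 0)"
    by (simp add: sq_def us fun_eq_iff)
  then have us_cost: "cost l T q r p us xs = K"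
    using cost_eq[OF us_adm] by (simp only: rect_integral_cmult)
  have us_opt: "optimal_pair l T c a b q r p x_init x_bd \<eta> us xs"
    unfolding optimal_pair_def
  proof (intro conjI allI impI us_adm)
    fix v y assume adm: "admissible_pair l T c a b x_init x_bd \<eta> v y"
    show "cost l T q r p us xs \<le> cost l T q r p v y"
      unfolding us_cost cost_eq[OF adm] using rect_integral_nonneg[OF sq_cont[OF adm] sq_nonneg] by simp
  qed

  have unique: "eq_on_rectangle l T u us \<and> eq_on_rectangle l T x xs"
    if opt: "optimal_pair l T c a b q r p x_init x_bd \<eta> u x" for u x
  proof -
    have adm: "admissible_pair l T c a b x_init x_bd \<eta> u x"
      using opt by (simp add: optimal_pair_def)
    have "cost l T q r p u x \<le> K"
      using opt us_adm us_cost unfolding optimal_pair_def by metis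
    then have "rect_integral l T (sq u x) = 0"
      using cost_eq[OF adm] rect_integral_nonneg[OF sq_cont[OF adm] sq_nonneg] by simp
    then have "sq u x z t = 0" if "z \<in> {0..l}" "t \<in> {0..T}" for z t
      using rect_integral_nonneg_eq_0[OF l T0 sq_cont[OF adm] sq_nonneg _ that] by simp
    then have u: "u z t = - (b / r) * (g z t * x z t + \<psi> z t)" if "z \<in> {0..l}" "t \<in> {0..T}" for z t
      using that r by (simp add: sq_def eq_neg_iff_add_eq_0)
    have "forward_solution l T c (\<lambda>z t y. a * y + b * u z t) x_init x_bd x"
      using adm by (simp add: admissible_pair_def state_solution_def)
    then have "forward_solution l T c (\<lambda>z t y. abar z t * y + bbar * \<psi> z t) x_init x_bd x"
      unfolding forward_solution_def closed_loop[symmetric] by (auto simp: u)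
    then have x: "eq_on_rectangle l T x xs"
      using xs_unique by blast
    then show ?thesis
      using u by (simp add: eq_on_rectangle_def us)
  qed

  \<comment> \<open>In \<open>K\<close>, the boundary terms carry \<open>1/2 g y\<^sup>2 + \<psi> y\<close> instead of \<open>1/2 (g y\<^sup>2 + \<psi> y)\<close>; the surplus
      \<open>1/2 \<psi> y\<close> is what the energy of \<open>\<psi>\<close> compensates.\<close>
  have J: "K = 1/2 * (integral {0..T} (\<lambda>t. c * x_bd t * (g l t * x_bd t + \<psi> l t)) +
             integral {0..l} (\<lambda>z. x_init z * (g z 0 * x_init z + \<psi> z 0)) -
             integral {0..l} (\<lambda>z. \<eta> z * \<gamma> z))"
  proof -
    have gl: "continuous_on {0..T} (g l)" and \<psi>l: "continuous_on {0..T} (\<psi> l)"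
      and g0: "continuous_on {0..l} (\<lambda>z. g z 0)" and \<psi>0: "continuous_on {0..l} (\<lambda>z. \<psi> z 0)"
      using C1_partials_slices_continuous_on[OF gp] C1_partials_slices_continuous_on[OF \<psi>p] l T0
      by auto
    have xi: "continuous_on {0..l} x_init" and xb: "continuous_on {0..T} x_bd"
      using x_init x_bd unfolding C1_on_interval_def by (auto intro: DERIV_continuous_on)
    have "integral {0..T} (\<lambda>t. 1/2 * g l t * (x_bd t)\<^sup>2 + \<psi> l t * x_bd t) =
        integral {0..T} (\<lambda>t. 1/2 * (x_bd t * (g l t * x_bd t + \<psi> l t)) + 1/2 * (\<psi> l t * x_bd t))"
      by (intro integral_cong) (simp add: power2_eq_square algebra_simps)
    also have "\<dots> = integral {0..T} (\<lambda>t. 1/2 * (x_bd t * (g l t * x_bd t + \<psi> l t))) +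
        integral {0..T} (\<lambda>t. 1/2 * (\<psi> l t * x_bd t))"
      by (intro integral_add integrable_continuous_interval continuous_intros gl \<psi>l xb)
    finally have bd: "integral {0..T} (\<lambda>t. 1/2 * g l t * (x_bd t)\<^sup>2 + \<psi> l t * x_bd t) =
        1/2 * integral {0..T} (\<lambda>t. x_bd t * (g l t * x_bd t + \<psi> l t)) +
        1/2 * integral {0..T} (\<lambda>t. \<psi> l t * x_bd t)"
      by (simp only: integral_mult_right)
    have "integral {0..l} (\<lambda>z. 1/2 * g z 0 * (x_init z)\<^sup>2 + \<psi> z 0 * x_init z) =
        integral {0..l} (\<lambda>z. 1/2 * (x_init z * (g z 0 * x_init z + \<psi> z 0)) + 1/2 * (\<psi> z 0 * x_init z))"
      by (intro integral_cong) (simp add: power2_eq_square algebra_simps)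
    also have "\<dots> = integral {0..l} (\<lambda>z. 1/2 * (x_init z * (g z 0 * x_init z + \<psi> z 0))) +
        integral {0..l} (\<lambda>z. 1/2 * (\<psi> z 0 * x_init z))"
      by (intro integral_add integrable_continuous_interval continuous_intros g0 \<psi>0 xi)
    finally have init: "integral {0..l} (\<lambda>z. 1/2 * g z 0 * (x_init z)\<^sup>2 + \<psi> z 0 * x_init z) =
        1/2 * integral {0..l} (\<lambda>z. x_init z * (g z 0 * x_init z + \<psi> z 0)) +
        1/2 * integral {0..l} (\<lambda>z. \<psi> z 0 * x_init z)"
      by (simp only: integral_mult_right)
    have "integral {0..l} (\<lambda>z. xs z T * \<gamma> z) = integral {0..l} (\<lambda>z. \<eta> z * \<gamma> z)"
      by (intro integral_cong) (simp add: reach)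
    then have "bbar * rect_integral l T (\<lambda>z t. (\<psi> z t)\<^sup>2) =
        integral {0..l} (\<lambda>z. \<eta> z * \<gamma> z) - integral {0..l} (\<lambda>z. \<psi> z 0 * x_init z) -
        c * integral {0..T} (\<lambda>t. \<psi> l t * x_bd t)"
      using closed_loop_psi_energy[OF l T0 \<psi> xs] by simp
    then show ?thesis
      unfolding K_def bd init by (simp add: mult.assoc) (simp add: field_simps)
  qed

  have costate: "optimal_costate l T c a b q r p \<gamma> us xs \<Lambda>"
    unfolding optimal_costate_def \<Lambda>_def using costate_feedback[OF g \<psi>' xs'] r by (simp add: us)
  have costate_unique: "eq_on_rectangle l T M \<Lambda>"
    if "optimal_costate l T c a b q r p \<gamma> us xs M" for M
    unfolding eq_on_rectangle_def
  proof (intro ballI)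
    fix z t assume zt: "z \<in> {0..l}" "t \<in> {0..T}"
    have "0 = r * us z t + b * M z t" "0 = r * us z t + b * \<Lambda> z t"
      using that costate zt by (simp_all add: optimal_costate_def)
    then have "b * M z t = b * \<Lambda> z t" by linarith
    then show "M z t = \<Lambda> z t" using b by simp
  qed
  have "solvable l T c a b q r p x_init x_bd \<eta>"
    using us_opt unfolding solvable_def by blast
  then show ?thesis
    unfolding \<Lambda>_def[symmetric] us_cost
    by (intro conjI allI impI unique[THEN conjunct1] unique[THEN conjunct2] us_opt J
        costate costate_unique)
qed

end
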